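(* Let $\Delta$ be an infinite rank 2 root system of type $H(a,b)$ with $a\ge b$ and $ab\ge4$. Put $\delta_d:=\eta_d-\eta_{d-1}$ and $\epsilon_d:=\gamma_{d+1}-\gamma_d$. Every nonempty $\Phi$-subsystem of $\Delta$ has simple roots, Cartan matrix and inner product matrix given by one of the following rows, for some integers $r$ (and $d$) satisfying the listed conditions: - Type $\mathrm{I}_L$: $r$ arbitrary; simple root $\alpha^{LL}_r$; Cartan matrix $A_1$; inner product matrix $\frac ab A_1$. - Type $\mathrm{I}_S$: $r$ arbitrary; simple root $\alpha^{SU}_r$; Cartan matrix $A_1$; inner product matrix $A_1$. - Type $\mathrm{II}_L$: $d>0$, $0\le r<d$; simple roots $\alpha^{LL}_r,\alpha^{LU}_{d-r-1}$; Cartan matrix $H(\delta_d,\delta_d)$; inner product matrix $\frac ab H(\delta_d,\delta_d)$. - Type $\mathrm{II}_S$: $d>0$, $0\le r<d$; simple roots $\alpha^{SU}_r,\alpha^{SL}_{d-r-1}$; Cartan matrix $H(\delta_d,\delta_d)$; inner product matrix $H(\delta_d,\delta_d)$. - Type $\mathrm{II}_{LS}$: $d\ge0$, $-d\le r\le d$; simple roots $\alpha^{LL}_r,\alpha^{SU}_{d-r}$; Cartan matrix $H(a\epsilon_d,b\epsilon_d)$; inner product matrix $B(a\epsilon_d,b\epsilon_d)$. In particular, all $\Phi$-subsystems of $\Delta$ have rank at most $2$.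
   Context: For positive integers $m,n$: $H(m,n)=\begin{pmatrix}2&-n\\-m&2\end{pmatrix}$, $B(m,n)=\begin{pmatrix}2m/n&-m\\-m&2\end{pmatrix}$; $A_1$ denotes the $1\times1$ matrix $(2)$. $\Delta$ is the root system of the Kac--Moody algebra with generalized Cartan matrix $H(a,b)$, $a,b$ positive integers. Simple roots are $\alpha_1,\alpha_2$; simple reflections $w_1(\alpha_1)=-\alpha_1$, $w_1(\alpha_2)=\alpha_2+b\alpha_1$, $w_2(\alpha_1)=\alpha_1+a\alpha_2$, $w_2(\alpha_2)=-\alpha_2$; $W=\langle w_1,w_2\rangle$; the symmetric bilinear form has Gram matrix $B(a,b)$ in the basis $\alpha_1,\alpha_2$; real roots $\Delta^{\mathrm{re}}=W\alpha_1\cup W\alpha_2$. For $j\in\mathbb Z$: $\alpha^{LL}_j=(w_1w_2)^j\alpha_1$, $\alpha^{LU}_j=(w_2w_1)^jw_2\alpha_1$, $\alpha^{SU}_j=(w_2w_1)^j\alpha_2$, $\alpha^{SL}_j=(w_1w_2)^jw_1\alpha_2$. The integer sequences $(\gamma_j)_{j\in\mathbb Z}$, $(\eta_j)_{j\in\mathbb Z}$ are given by $\gamma_0=0$, $\gamma_1=1$, $\eta_0=1$, $\eta_1=ab-1$, both satisfying $X_j=(ab-2)X_{j-1}-X_{j-2}$. For a real root $\alpha$, $w_\alpha(\beta)=\beta-\frac{2(\beta,\alpha)}{(\alpha,\alpha)}\alpha$. For $\Gamma\subseteq\Delta^{\mathrm{re}}$, $W_\Gamma=\langle w_\alpha:\alpha\in\Gamma\rangle$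 and $\Phi(\Gamma)=W_\Gamma\cdot\Gamma$; sets of this form are called $\Phi$-subsystems. A $\Phi$-subsystem $\Psi$ has simple roots $\beta_1,\dots,\beta_k$ (linearly independent elements of $\Psi$, not required to be positive in $\Delta$) if $\Psi=W_{\{\beta_1,\dots,\beta_k\}}\cdot\{\beta_1,\dots,\beta_k\}$ and every element of $\Psi$ is a nonnegative or nonpositive integer combination of the $\beta_i$; its rank is $k$, its Cartan matrix is $\left(\frac{2(\beta_i,\beta_j)}{(\beta_i,\beta_i)}\right)_{i,j}$ and its inner product matrix is $((\beta_i,\beta_j))_{i,j}$. *)

theory Defs
  imports
    "HOL-Analysis.Product_Vector"
    "HOL-Algebra.Bij"
    "HOL-Algebra.Generated_Groups"
    "Jordan_Normal_Form.Matrix"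
begin

section \<open>Matrices\<close>

definition H_mat :: "int \<Rightarrow> int \<Rightarrow> real mat" where
  "H_mat m n = mat_of_rows_list 2 [[2, - of_int n], [- of_int m, 2]]"

definition B_mat :: "int \<Rightarrow> int \<Rightarrow> real mat" where
  "B_mat m n = mat_of_rows_list 2 [[2 * of_int m / of_int n, - of_int m], [- of_int m, 2]]"

definition A1_mat :: "real mat" where
  "A1_mat = mat_of_rows_list 1 [[2]]"

section \<open>The real roots of type \<open>H(a,b)\<close>\<close>

text \<open>
  The pair \<open>(x, y)\<close> stands for \<open>x \<alpha>\<^sub>1 + y \<alpha>\<^sub>2\<close> in the real span of the root lattice.  Imaginary
  roots play no role below, since \<open>\<Phi>\<close>-subsystems consist of real roots.
\<close>

type_synonym rvec = "real \<times> real"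

definition alpha1 :: rvec where "alpha1 = (1, 0)"
definition alpha2 :: rvec where "alpha2 = (0, 1)"

definition ip :: "int \<Rightarrow> int \<Rightarrow> rvec \<Rightarrow> rvec \<Rightarrow> real" where
  "ip a b x y =
     fst x * B_mat a b $$ (0,0) * fst y + fst x * B_mat a b $$ (0,1) * snd y
   + snd x * B_mat a b $$ (1,0) * fst y + snd x * B_mat a b $$ (1,1) * snd y"

text \<open>The simple reflections, given on \<open>\<alpha>\<^sub>1, \<alpha>\<^sub>2\<close> and extended linearly.\<close>

definition w1 :: "int \<Rightarrow> rvec \<Rightarrow> rvec" where
  "w1 b x = fst x *\<^sub>R (- alpha1) + snd x *\<^sub>R (alpha2 + of_int b *\<^sub>R alpha1)"

definition w2 :: "int \<Rightarrow> rvec \<Rightarrow> rvec" where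
  "w2 a x = fst x *\<^sub>R (alpha1 + of_int a *\<^sub>R alpha2) + snd x *\<^sub>R (- alpha2)"

text \<open>All groups are subgroups of the group of bijections of the whole space.\<close>

abbreviation Sym :: "(rvec \<Rightarrow> rvec) monoid" where
  "Sym \<equiv> BijGroup UNIV"

definition orbit_set :: "(rvec \<Rightarrow> rvec) set \<Rightarrow> rvec set \<Rightarrow> rvec set" where
  "orbit_set G X = {g x | g x. g \<in> G \<and> x \<in> X}"

definition Weyl :: "int \<Rightarrow> int \<Rightarrow> (rvec \<Rightarrow> rvec) set" where
  "Weyl a b = generate Sym {w1 b, w2 a}"

definition real_roots :: "int \<Rightarrow> int \<Rightarrow> rvec set" where
  "real_roots a b = orbit_set (Weyl a b) {alpha1} \<union> orbit_set (Weyl a b) {alpha2}"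

definition alphaLL :: "int \<Rightarrow> int \<Rightarrow> int \<Rightarrow> rvec" where
  "alphaLL a b j = ((w1 b \<circ> w2 a) [^]\<^bsub>Sym\<^esub> j) alpha1"

definition alphaLU :: "int \<Rightarrow> int \<Rightarrow> int \<Rightarrow> rvec" where
  "alphaLU a b j = ((w2 a \<circ> w1 b) [^]\<^bsub>Sym\<^esub> j) (w2 a alpha1)"

definition alphaSU :: "int \<Rightarrow> int \<Rightarrow> int \<Rightarrow> rvec" where
  "alphaSU a b j = ((w2 a \<circ> w1 b) [^]\<^bsub>Sym\<^esub> j) alpha2"

definition alphaSL :: "int \<Rightarrow> int \<Rightarrow> int \<Rightarrow> rvec" where
  "alphaSL a b j = ((w1 b \<circ> w2 a) [^]\<^bsub>Sym\<^esub> j) (w1 b alpha2)"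

section \<open>\<open>\<Phi>\<close>-subsystems\<close>

definition refl_root :: "int \<Rightarrow> int \<Rightarrow> rvec \<Rightarrow> rvec \<Rightarrow> rvec" where
  "refl_root a b \<alpha> \<beta> = \<beta> - (2 * ip a b \<beta> \<alpha> / ip a b \<alpha> \<alpha>) *\<^sub>R \<alpha>"

definition W_sub :: "int \<Rightarrow> int \<Rightarrow> rvec set \<Rightarrow> (rvec \<Rightarrow> rvec) set" where
  "W_sub a b \<Gamma> = generate Sym (refl_root a b ` \<Gamma>)"

definition Phi :: "int \<Rightarrow> int \<Rightarrow> rvec set \<Rightarrow> rvec set" where
  "Phi a b \<Gamma> = orbit_set (W_sub a b \<Gamma>) \<Gamma>"

definition Phi_subsystem :: "int \<Rightarrow> int \<Rightarrow> rvec set \<Rightarrow> bool" where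
  "Phi_subsystem a b \<Psi> \<longleftrightarrow> (\<exists>\<Gamma> \<subseteq> real_roots a b. \<Psi> = Phi a b \<Gamma>)"

definition simple_roots :: "int \<Rightarrow> int \<Rightarrow> rvec set \<Rightarrow> rvec list \<Rightarrow> bool" where
  "simple_roots a b \<Psi> \<beta>s \<longleftrightarrow>
     set \<beta>s \<subseteq> \<Psi> \<and> distinct \<beta>s \<and> independent (set \<beta>s) \<and>
     \<Psi> = Phi a b (set \<beta>s) \<and>
     (\<forall>\<beta>\<in>\<Psi>. \<exists>c :: nat \<Rightarrow> int.
        \<beta> = (\<Sum>i<length \<beta>s. of_int (c i) *\<^sub>R (\<beta>s ! i)) \<and>
        ((\<forall>i<length \<beta>s. c i \<ge> 0) \<or> (\<forall>i<length \<beta>s. c i \<le> 0)))"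

definition has_rank :: "int \<Rightarrow> int \<Rightarrow> rvec set \<Rightarrow> nat \<Rightarrow> bool" where
  "has_rank a b \<Psi> k \<longleftrightarrow> (\<exists>\<beta>s. simple_roots a b \<Psi> \<beta>s \<and> length \<beta>s = k)"

definition cartan_mat :: "int \<Rightarrow> int \<Rightarrow> rvec list \<Rightarrow> real mat" where
  "cartan_mat a b \<beta>s = mat (length \<beta>s) (length \<beta>s)
     (\<lambda>(i,j). 2 * ip a b (\<beta>s ! i) (\<beta>s ! j) / ip a b (\<beta>s ! i) (\<beta>s ! i))"

definition ip_mat :: "int \<Rightarrow> int \<Rightarrow> rvec list \<Rightarrow> real mat" where
  "ip_mat a b \<beta>s = mat (length \<beta>s) (length \<beta>s) (\<lambda>(i,j). ip a b (\<beta>s ! i) (\<beta>s ! j))"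

definition has_data :: "int \<Rightarrow> int \<Rightarrow> rvec set \<Rightarrow> rvec list \<Rightarrow> real mat \<Rightarrow> real mat \<Rightarrow> bool" where
  "has_data a b \<Psi> \<beta>s C M \<longleftrightarrow>
     simple_roots a b \<Psi> \<beta>s \<and> cartan_mat a b \<beta>s = C \<and> ip_mat a b \<beta>s = M"

section \<open>The integer sequences\<close>

text \<open>
  The two-sided sequence with values \<open>x0\<close>, \<open>x1\<close> at \<open>0\<close>, \<open>1\<close> and
  \<open>X j = c * X (j - 1) - X (j - 2)\<close> for all integers \<open>j\<close>; see \<open>lin_rec_rec\<close> below.
\<close>

function lin_rec :: "int \<Rightarrow> int \<Rightarrow> int \<Rightarrow> int \<Rightarrow> int" where
  "lin_rec c x0 x1 j =
     (if j = 0 then x0 else if j = 1 then x1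
      else if j > 1 then c * lin_rec c x0 x1 (j - 1) - lin_rec c x0 x1 (j - 2)
      else c * lin_rec c x0 x1 (j + 1) - lin_rec c x0 x1 (j + 2))"
  by pat_completeness auto
termination
  by (relation "measure (\<lambda>(c, x0, x1, j). nat \<bar>2 * j - 1\<bar>)") auto

declare lin_rec.simps [simp del]

lemma lin_rec_0 [simp]: "lin_rec c x0 x1 0 = x0"
  and lin_rec_1 [simp]: "lin_rec c x0 x1 1 = x1"
  by (simp_all add: lin_rec.simps)

lemma lin_rec_rec: "lin_rec c x0 x1 j = c * lin_rec c x0 x1 (j - 1) - lin_rec c x0 x1 (j - 2)"
proof (cases "j > 1")
  case True
  then show ?thesis by (subst lin_rec.simps) auto
next
  case False
  then have "lin_rec c x0 x1 (j - 2) = c * lin_rec c x0 x1 (j - 1) - lin_rec c x0 x1 j"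
    by (subst lin_rec.simps) auto
  then show ?thesis by simp
qed

definition gamma :: "int \<Rightarrow> int \<Rightarrow> int \<Rightarrow> int" where
  "gamma a b = lin_rec (a * b - 2) 0 1"

definition eta :: "int \<Rightarrow> int \<Rightarrow> int \<Rightarrow> int" where
  "eta a b = lin_rec (a * b - 2) 1 (a * b - 1)"

definition delta :: "int \<Rightarrow> int \<Rightarrow> int \<Rightarrow> int" where
  "delta a b d = eta a b d - eta a b (d - 1)"

definition epsilon :: "int \<Rightarrow> int \<Rightarrow> int \<Rightarrow> int" where
  "epsilon a b d = gamma a b (d + 1) - gamma a b d"

section \<open>Well-definedness\<close>

text \<open>
  Powers and generated subgroups in \<open>Sym\<close> are only meaningful for elements of its carrier.
\<close>

lemma w1_in_Sym: "w1 b \<in> carrier Sym"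
proof -
  have "w1 b (w1 b x) = x" for x
    by (cases x) (simp add: w1_def alpha1_def alpha2_def)
  then have "bij (w1 b)" by (intro o_bij[of "w1 b"]) auto
  then show ?thesis by (simp add: BijGroup_def Bij_def extensional_def)
qed

lemma w2_in_Sym: "w2 a \<in> carrier Sym"
proof -
  have "w2 a (w2 a x) = x" for x
    by (cases x) (simp add: w2_def alpha1_def alpha2_def)
  then have "bij (w2 a)" by (intro o_bij[of "w2 a"]) auto
  then show ?thesis by (simp add: BijGroup_def Bij_def extensional_def)
qed

lemma refl_root_in_Sym:
  assumes "ip a b \<alpha> \<alpha> \<noteq> 0"
  shows "refl_root a b \<alpha> \<in> carrier Sym"
proof -
  have lin: "ip a b (x - c *\<^sub>R \<alpha>) \<alpha> = ip a b x \<alpha> - c * ip a b \<alpha> \<alpha>" for x c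
    by (simp add: ip_def algebra_simps)
  have "refl_root a b \<alpha> (refl_root a b \<alpha> x) = x" for x
    using assms by (simp add: refl_root_def lin flip: scaleR_add_left)
  then have "bij (refl_root a b \<alpha>)" by (intro o_bij[of "refl_root a b \<alpha>"]) auto
  then show ?thesis by (simp add: BijGroup_def Bij_def extensional_def)
qed

lemma refl_root_simple:
  assumes "a > 0" "b > 0"
  shows "refl_root a b alpha1 = w1 b" "refl_root a b alpha2 = w2 a"
  using assms
  by (auto simp: fun_eq_iff refl_root_def ip_def w1_def w2_def alpha1_def alpha2_def
      B_mat_def mat_of_rows_list_def field_simps)

end

theory Submission
  imports Defs "HOL-Analysis.Linear_Algebra"
begin

text \<open>
  The Weyl group is infinite dihedral, so its reflections sit on a line at the integer points.  The
  real roots follow the same pattern: they are the vectors \<open>\<plusminus>\<beta>\<^sub>k\<close> for \<open>k \<in> \<int>\<close>, where \<open>\<beta>\<^sub>0 = \<alpha>\<^sub>1\<close>,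
  \<open>\<beta>\<^bsub>-1\<^esub> = -\<alpha>\<^sub>2\<close> and \<open>\<beta>\<^bsub>k+1\<^esub> + \<beta>\<^bsub>k-1\<^esub>\<close> is \<open>b\<close> or \<open>a\<close> times \<open>\<beta>\<^sub>k\<close>, according to the parity of
  \<open>k\<close>.  The even terms are the roots in the orbit of \<open>\<alpha>\<^sub>1\<close> (families \<open>LL\<close>, \<open>LU\<close>), the odd ones those
  in the orbit of \<open>\<alpha>\<^sub>2\<close> (families \<open>SL\<close>, \<open>SU\<close>), by \<open>alphas_eq_chain\<close>.

  The step relation propagates to every distance \<open>D\<close>: \<open>\<beta>\<^bsub>k+D\<^esub> + \<beta>\<^bsub>k-D\<^esub>\<close> is a multiple of \<open>\<beta>\<^sub>k\<close>, with
  coefficient \<open>\<delta>\<^sub>d\<close> for \<open>D = 2d\<close> and \<open>b\<epsilon>\<^sub>d\<close> or \<open>a\<epsilon>\<^sub>d\<close> for \<open>D = 2d + 1\<close> (\<open>chain_add\<close>).  This coefficient is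
  also \<open>2(\<beta>\<^sub>k, \<beta>\<^bsub>k+D\<^esub>) / (\<beta>\<^sub>k, \<beta>\<^sub>k)\<close>, hence the reflection in \<open>\<beta>\<^sub>k\<close> sends \<open>\<beta>\<^sub>j\<close> to \<open>-\<beta>\<^bsub>2k-j\<^esub>\<close>
  (\<open>refl_root_chain\<close>): up to sign it is the reflection of the line in the point \<open>k\<close>.

  A \<open>\<Phi>\<close>-subsystem is therefore \<open>{\<plusminus>\<beta>\<^sub>k | k \<in> K}\<close> for a set \<open>K\<close> of integers closed under
  \<open>j \<mapsto> 2k - j\<close> for \<open>k \<in> K\<close>, and a nonempty such \<open>K\<close> is a point or a full arithmetic progression
  \<open>p + D\<int>\<close> (\<open>refl_closed_cases\<close>).  In the second case the neighbours \<open>\<beta>\<^bsub>p+D\<^esub>\<close> and \<open>-\<beta>\<^sub>p\<close> are simple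
  roots: their reflections generate the reflections in all points of the progression, and each
  \<open>\<beta>\<^bsub>p+mD\<^esub>\<close> is a combination of them with coefficients of one sign.  The signs come from the
  recurrence, since two consecutive coefficients have a product of at least \<open>4\<close>, which is where
  \<open>ab \<ge> 4\<close> enters (\<open>chain_positive_combination\<close>).  The types correspond to the parities of \<open>p\<close>
  and \<open>D\<close>, and \<open>r\<close> is a normalised choice of the base point within the progression.
\<close>

section \<open>Integer sequences\<close>

lemma int_two_step_induct:
  fixes k :: int
  assumes "P 0" "P 1"
    and up: "\<And>k. P (k - 1) \<Longrightarrow> P k \<Longrightarrow> P (k + 1)"
    and down: "\<And>k. P k \<Longrightarrow> P (k + 1) \<Longrightarrow> P (k - 1)"
  shows "P k"
proof -
  have "P k \<and> P (k + 1)"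
  proof (induction k rule: int_induct[where k = 0])
    case base
    then show ?case using assms(1,2) by simp
  next
    case (step1 i)
    then show ?case using up[of "i + 1"] by simp
  next
    case (step2 i)
    then show ?case using down[of i] by simp
  qed
  then show ?thesis ..
qed

text \<open>
  A recurrence \<open>X\<^bsub>j+1\<^esub> = c X\<^sub>j - X\<^bsub>j-1\<^esub>\<close> with \<open>c \<ge> 2\<close> is convex on nonnegative values, so a sequence
  that has begun to grow keeps growing.
\<close>

lemma lin_rec_mono_from_0:
  fixes X :: "int \<Rightarrow> int"
  assumes rec: "\<And>j. X (j + 1) = c * X j - X (j - 1)"
    and c: "c \<ge> 2" and X: "0 \<le> X 0" "X (- 1) \<le> X 0" and d: "d \<ge> 0"
  shows "X 0 \<le> X d"
proof -
  have "X 0 \<le> X i \<and> X (i - 1) \<le> X i" if "i \<ge> 0" for i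
    using that
  proof (induction i rule: int_ge_induct)
    case base
    then show ?case using X by simp
  next
    case (step i)
    have "2 * X i \<le> c * X i" using step X c by (intro mult_right_mono) auto
    then show ?case using step rec[of i] by simp
  qed
  then show ?thesis using d by blast
qed

lemma gamma_rec: "gamma a b (j + 1) = (a * b - 2) * gamma a b j - gamma a b (j - 1)"
  unfolding gamma_def using lin_rec_rec[of "a * b - 2" 0 1 "j + 1"] by simp

text \<open>
  With this identity \<open>\<eta>\<close> can be eliminated.  The two sequences \<open>\<delta>\<close> and \<open>\<epsilon>\<close> then interlace:
  \<open>\<delta>\<^sub>d = \<epsilon>\<^sub>d + \<epsilon>\<^bsub>d-1\<^esub>\<close> and \<open>ab \<epsilon>\<^sub>d = \<delta>\<^bsub>d+1\<^esub> + \<delta>\<^sub>d\<close>, the shape in which they arise along the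
  chain of roots below.
\<close>

lemma eta_eq_gamma: "eta a b j = gamma a b (j + 1) + gamma a b j"
proof (induction j rule: int_two_step_induct)
  case 1
  then show ?case by (simp add: eta_def gamma_def)
next
  case 2
  then show ?case using gamma_rec[of a b 1] by (simp add: eta_def gamma_def)
next
  case (3 k)
  then show ?case
    using gamma_rec[of a b k] gamma_rec[of a b "k + 1"] lin_rec_rec[of "a * b - 2" 1 "a * b - 1" "k + 1"]
    by (simp add: eta_def algebra_simps)
next
  case (4 k)
  then show ?case
    using gamma_rec[of a b k] gamma_rec[of a b "k + 1"] lin_rec_rec[of "a * b - 2" 1 "a * b - 1" "k + 1"]
    by (simp add: eta_def algebra_simps)
qed

lemma eta_add_eta: "eta a b j + eta a b (j - 1) = a * b * gamma a b j"
  using gamma_rec[of a b j] by (simp add: eta_eq_gamma algebra_simps)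

lemma delta_eq_epsilon: "delta a b d = epsilon a b d + epsilon a b (d - 1)"
  by (simp add: delta_def epsilon_def eta_eq_gamma)

lemma delta_add_delta: "delta a b (d + 1) + delta a b d = a * b * epsilon a b d"
  using eta_add_eta[of a b d] eta_add_eta[of a b "d + 1"]
  by (simp add: delta_def epsilon_def algebra_simps)

lemma epsilon_ge_1:
  assumes "a * b \<ge> 4" "d \<ge> 0"
  shows "epsilon a b d \<ge> 1"
proof -
  have rec: "epsilon a b (j + 1) = (a * b - 2) * epsilon a b j - epsilon a b (j - 1)" for j
    using delta_add_delta[of a b j] by (simp add: delta_eq_epsilon algebra_simps)
  have "epsilon a b 0 = 1" "epsilon a b (- 1) = 1"
    using gamma_rec[of a b 0] by (simp_all add: epsilon_def gamma_def)
  then show ?thesis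
    using lin_rec_mono_from_0[of "epsilon a b", OF rec] assms by simp
qed

lemma delta_ge_2:
  assumes "a * b \<ge> 4" "d > 0"
  shows "delta a b d \<ge> 2"
  using epsilon_ge_1[of a b d] epsilon_ge_1[of a b "d - 1"] assms by (simp add: delta_eq_epsilon)

section \<open>Reflections\<close>

lemma ip_simps:
  assumes "b \<noteq> 0"
  shows "ip a b (x - y) z = ip a b x z - ip a b y z"
    "ip a b x (y - z) = ip a b x y - ip a b x z"
    "ip a b (c *\<^sub>R x) y = c * ip a b x y"
    "ip a b x (c *\<^sub>R y) = c * ip a b x y"
    "ip a b (- x) y = - ip a b x y"
    "ip a b x (- y) = - ip a b x y"
  by (simp_all add: ip_def algebra_simps)

lemma ip_commute: "ip a b x y = ip a b y x"
  by (simp add: ip_def B_mat_def mat_of_rows_list_def)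

lemma Sym_mult: "f \<in> carrier Sym \<Longrightarrow> g \<in> carrier Sym \<Longrightarrow> f \<otimes>\<^bsub>Sym\<^esub> g = f \<circ> g"
  by (simp add: BijGroup_def compose_def fun_eq_iff)

lemma Sym_one: "\<one>\<^bsub>Sym\<^esub> = id"
  by (simp add: BijGroup_def fun_eq_iff)

lemma Sym_pow_shift:
  fixes F :: "int \<Rightarrow> rvec"
  assumes g: "g \<in> carrier Sym" and shift: "\<And>k. g (F k) = F (k + m)"
  shows "(g [^]\<^bsub>Sym\<^esub> (j :: int)) (F k) = F (k + m * j)"
proof -
  interpret group Sym by (rule group_BijGroup)
  have Suc: "(g [^]\<^bsub>Sym\<^esub> (i + 1)) x = g ((g [^]\<^bsub>Sym\<^esub> i) x)" for i :: int and x
    using int_pow_mult[OF g, of 1 i] g by (simp add: Sym_mult add.commute)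
  have inj: "inj g"
    using g by (simp add: BijGroup_def Bij_def bij_is_inj)
  show ?thesis
  proof (induction j rule: int_induct[where k = 0])
    case base
    then show ?case by (simp add: Sym_one)
  next
    case (step1 i)
    show ?case unfolding Suc step1 shift by (simp add: algebra_simps)
  next
    case (step2 i)
    have "g ((g [^]\<^bsub>Sym\<^esub> (i - 1)) (F k)) = g (F (k + m * (i - 1)))"
      using step2 Suc[of "i - 1" "F k"] by (simp add: shift algebra_simps)
    then show ?case using inj by (simp add: inj_eq)
  qed
qed

lemma refl_root_linear:
  assumes "b \<noteq> 0"
  shows "refl_root a b \<gamma> (x - y) = refl_root a b \<gamma> x - refl_root a b \<gamma> y"
    "refl_root a b \<gamma> (c *\<^sub>R x) = c *\<^sub>R refl_root a b \<gamma> x"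
    "refl_root a b \<gamma> (- x) = - refl_root a b \<gamma> x"
  by (simp_all add: refl_root_def ip_simps[OF assms] algebra_simps add_divide_distrib diff_divide_distrib)

lemma refl_root_uminus:
  assumes "b \<noteq> 0"
  shows "refl_root a b (- \<gamma>) = refl_root a b \<gamma>"
  by (simp add: refl_root_def ip_simps[OF assms] fun_eq_iff)

lemma refl_root_self: "ip a b \<gamma> \<gamma> \<noteq> 0 \<Longrightarrow> refl_root a b \<gamma> \<gamma> = - \<gamma>"
  by (simp add: refl_root_def scaleR_2)

lemma refl_root_invol:
  assumes "b \<noteq> 0" "ip a b \<gamma> \<gamma> \<noteq> 0"
  shows "refl_root a b \<gamma> (refl_root a b \<gamma> x) = x"
  using assms by (simp add: refl_root_def ip_simps)

lemma ip_refl_root: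
  assumes "b \<noteq> 0" "ip a b \<gamma> \<gamma> \<noteq> 0"
  shows "ip a b (refl_root a b \<gamma> x) (refl_root a b \<gamma> y) = ip a b x y"
  using assms(2) by (simp add: refl_root_def ip_simps[OF assms(1)] ip_commute[of a b \<gamma> y] field_simps)

text \<open>
  The usual conjugation law \<open>w\<^bsub>g\<alpha>\<^esub> = g w\<^sub>\<alpha> g\<inverse>\<close> for the isometry \<open>g = w\<^sub>\<gamma>\<close>, an involution.
\<close>

lemma refl_root_conj:
  assumes b: "b \<noteq> 0" and \<gamma>: "ip a b \<gamma> \<gamma> \<noteq> 0"
  shows "refl_root a b (refl_root a b \<gamma> \<alpha>) \<beta>
    = refl_root a b \<gamma> (refl_root a b \<alpha> (refl_root a b \<gamma> \<beta>))"
proof -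
  have "ip a b (refl_root a b \<gamma> \<beta>) \<alpha> = ip a b \<beta> (refl_root a b \<gamma> \<alpha>)"
    using ip_refl_root[OF b \<gamma>, of "refl_root a b \<gamma> \<beta>" \<alpha>] by (simp add: refl_root_invol[OF b \<gamma>])
  then show ?thesis
    by (simp add: refl_root_def[of a b \<alpha>] refl_root_def[of a b "refl_root a b \<gamma> \<alpha>"]
        refl_root_linear[OF b] refl_root_invol[OF b \<gamma>] ip_refl_root[OF b \<gamma>])
qed

section \<open>Sets generated by reflections\<close>

lemma Phi_incl: "\<Gamma> \<subseteq> Phi a b \<Gamma>"
proof
  fix x assume "x \<in> \<Gamma>"
  moreover have "id \<in> W_sub a b \<Gamma>"
    using generate.one[of Sym "refl_root a b ` \<Gamma>"] by (simp add: W_sub_def Sym_one)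
  ultimately show "x \<in> Phi a b \<Gamma>"
    unfolding Phi_def orbit_set_def by (metis (mono_tags, lifting) id_apply mem_Collect_eq)
qed

context
  fixes a b :: int and \<Gamma> :: "rvec set"
  assumes b: "b \<noteq> 0" and anisotropic: "\<forall>\<gamma>\<in>\<Gamma>. ip a b \<gamma> \<gamma> \<noteq> 0"
begin

lemma W_sub_carrier: "W_sub a b \<Gamma> \<subseteq> carrier Sym"
  unfolding W_sub_def
  by (rule group.generate_incl[OF group_BijGroup]) (use anisotropic refl_root_in_Sym in auto)

lemma Phi_closed_generators:
  assumes "\<gamma> \<in> \<Gamma>" "\<beta> \<in> Phi a b \<Gamma>"
  shows "refl_root a b \<gamma> \<beta> \<in> Phi a b \<Gamma>"
proof -
  obtain g x where gx: "g \<in> W_sub a b \<Gamma>" "x \<in> \<Gamma>" "\<beta> = g x"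
    using assms(2) by (auto simp: Phi_def orbit_set_def)
  have "refl_root a b \<gamma> \<otimes>\<^bsub>Sym\<^esub> g \<in> W_sub a b \<Gamma>"
    using assms(1) gx(1) unfolding W_sub_def by (blast intro: generate.eng generate.incl)
  moreover have "refl_root a b \<gamma> \<otimes>\<^bsub>Sym\<^esub> g = refl_root a b \<gamma> \<circ> g"
    using gx(1) W_sub_carrier assms(1) anisotropic by (intro Sym_mult refl_root_in_Sym) auto
  ultimately show ?thesis
    using gx(2,3) unfolding Phi_def orbit_set_def
    by (metis (mono_tags, lifting) comp_apply mem_Collect_eq)
qed

text \<open>
  \<open>\<Phi>(\<Gamma>)\<close> is the least set containing \<open>\<Gamma>\<close> and stable under its reflections.  This induction
  principle replaces reasoning about words in the generated group from here on.
\<close>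

lemma Phi_minimal:
  assumes "\<Gamma> \<subseteq> R" and closed: "\<And>\<gamma> \<beta>. \<gamma> \<in> \<Gamma> \<Longrightarrow> \<beta> \<in> R \<Longrightarrow> refl_root a b \<gamma> \<beta> \<in> R"
  shows "Phi a b \<Gamma> \<subseteq> R"
proof -
  interpret group Sym by (rule group_BijGroup)
  have carrier: "refl_root a b \<gamma> \<in> carrier Sym" if "\<gamma> \<in> \<Gamma>" for \<gamma>
    using that anisotropic by (simp add: refl_root_in_Sym)
  have "g ` R \<subseteq> R" if "g \<in> generate Sym (refl_root a b ` \<Gamma>)" for g
    using that
  proof induction
    case one
    then show ?case by (simp add: Sym_one)
  next
    case (incl h)
    then show ?case using closed by auto
  next
    case (inv h)
    then obtain \<gamma> where \<gamma>: "\<gamma> \<in> \<Gamma>" "h = refl_root a b \<gamma>" by auto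
    have "h \<otimes>\<^bsub>Sym\<^esub> h = \<one>\<^bsub>Sym\<^esub>"
      unfolding \<gamma>(2) Sym_mult[OF carrier[OF \<gamma>(1)] carrier[OF \<gamma>(1)]] Sym_one
      using refl_root_invol[OF b bspec[OF anisotropic \<gamma>(1)]] by (intro ext) simp
    then have "inv\<^bsub>Sym\<^esub> h = h"
      using \<gamma> carrier by (simp add: inv_equality)
    then show ?case using \<gamma> closed by (simp add: image_subset_iff)
  next
    case (eng h1 h2)
    then have "h1 \<otimes>\<^bsub>Sym\<^esub> h2 = h1 \<circ> h2"
      using W_sub_carrier unfolding W_sub_def by (intro Sym_mult) auto
    then show ?case using eng.IH by auto
  qed
  then show ?thesis
    using assms(1) by (force simp: Phi_def orbit_set_def W_sub_def)
qed

lemma Phi_anisotropic: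
  assumes "\<alpha> \<in> Phi a b \<Gamma>"
  shows "ip a b \<alpha> \<alpha> \<noteq> 0"
proof -
  have "Phi a b \<Gamma> \<subseteq> {\<alpha>. ip a b \<alpha> \<alpha> \<noteq> 0}"
    by (rule Phi_minimal) (use anisotropic in \<open>auto simp: ip_refl_root[OF b]\<close>)
  then show ?thesis using assms by auto
qed

text \<open>
  Stability under the reflections in the generators extends to the reflections in all of \<open>\<Phi>(\<Gamma>)\<close>:
  by the conjugation law the vectors whose reflection preserves \<open>\<Phi>(\<Gamma>)\<close> form a set to which
  minimality applies.
\<close>

lemma Phi_closed:
  assumes "\<alpha> \<in> Phi a b \<Gamma>" "\<beta> \<in> Phi a b \<Gamma>"
  shows "refl_root a b \<alpha> \<beta> \<in> Phi a b \<Gamma>"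
proof -
  have "Phi a b \<Gamma> \<subseteq> {\<alpha>. \<forall>\<beta>\<in>Phi a b \<Gamma>. refl_root a b \<alpha> \<beta> \<in> Phi a b \<Gamma>}"
    by (rule Phi_minimal)
      (use Phi_closed_generators anisotropic in \<open>auto simp: refl_root_conj[OF b]\<close>)
  then show ?thesis using assms by auto
qed

lemma Phi_uminus:
  assumes "\<alpha> \<in> Phi a b \<Gamma>"
  shows "- \<alpha> \<in> Phi a b \<Gamma>"
  using Phi_closed[OF assms assms] refl_root_self[OF Phi_anisotropic[OF assms]] by simp

end

section \<open>The chain of real roots\<close>

text \<open>
  The roots \<open>\<beta>\<^sub>k\<close> of the introduction in closed form.  The signs are chosen so that the step relation
  holds across \<open>k = 0\<close>: \<open>chain a b k\<close> is a positive root for \<open>k \<ge> 0\<close> and a negative one for \<open>k < 0\<close>.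
\<close>

definition chain :: "int \<Rightarrow> int \<Rightarrow> int \<Rightarrow> rvec" where
  "chain a b k =
    (if even k then (of_int (eta a b (k div 2)), of_int (a * gamma a b (k div 2)))
     else (of_int (b * gamma a b (k div 2 + 1)), of_int (eta a b (k div 2))))"

definition step_coeff :: "int \<Rightarrow> int \<Rightarrow> int \<Rightarrow> int" where
  "step_coeff a b k = (if even k then b else a)"

definition chain_coeff :: "int \<Rightarrow> int \<Rightarrow> int \<Rightarrow> int \<Rightarrow> int" where
  "chain_coeff a b k D =
    (if even D then delta a b (D div 2) else step_coeff a b k * epsilon a b (D div 2))"

lemma chain_step:
  "chain a b (k + 1) + chain a b (k - 1) = of_int (step_coeff a b k) *\<^sub>R chain a b k"
proof (cases "even k")
  case True
  then obtain j where k: "k = 2 * j" by auto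
  have "(k + 1) div 2 = j" "(k - 1) div 2 = j - 1" using k by auto
  then show ?thesis
    using k eta_eq_gamma[of a b j] eta_add_eta[of a b j]
    by (simp add: chain_def step_coeff_def flip: of_int_mult of_int_add)
       (simp add: algebra_simps)
next
  case False
  then obtain j where k: "k = 2 * j + 1" by (rule oddE)
  then show ?thesis
    using eta_eq_gamma[of a b j] eta_add_eta[of a b "j + 1"]
    by (simp add: chain_def step_coeff_def flip: of_int_mult of_int_add)
       (simp add: algebra_simps)
qed

lemma chain_coeff_step:
  "chain_coeff a b k (D + 1) + chain_coeff a b k (D - 1)
    = step_coeff a b (k + D) * chain_coeff a b k D"
proof (cases "even D")
  case True
  then obtain d where D: "D = 2 * d" by auto
  have "(D + 1) div 2 = d" "(D - 1) div 2 = d - 1" using D by auto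
  moreover have "even (k + D) = even k" "odd (D + 1)" "odd (D - 1)" "D div 2 = d" using D by auto
  ultimately show ?thesis
    using True by (simp add: chain_coeff_def step_coeff_def delta_eq_epsilon distrib_left)
next
  case False
  then obtain d where D: "D = 2 * d + 1" by (rule oddE)
  then show ?thesis
    using delta_add_delta[of a b d] by (simp add: chain_coeff_def step_coeff_def algebra_simps)
qed

lemma chain_coeff_0: "chain_coeff a b k 0 = 2"
  using eta_add_eta[of a b 0] by (simp add: chain_coeff_def delta_def eta_def gamma_def)

lemma chain_coeff_1: "chain_coeff a b k 1 = step_coeff a b k"
  by (simp add: chain_coeff_def epsilon_def gamma_def)

text \<open>
  Both sides satisfy the same recurrence in \<open>D\<close>: adding the step relations at \<open>k + D\<close> and \<open>k - D\<close>,
  whose coefficients agree by parity, gives the one for the left side.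
\<close>

lemma chain_add:
  "chain a b (k + D) + chain a b (k - D) = of_int (chain_coeff a b k D) *\<^sub>R chain a b k"
proof (induction D rule: int_two_step_induct)
  case 1
  then show ?case by (simp add: chain_coeff_0 scaleR_2)
next
  case 2
  then show ?case by (simp add: chain_step chain_coeff_1)
next
  have sum: "(chain a b (k + (D + 1)) + chain a b (k - (D + 1)))
      + (chain a b (k + (D - 1)) + chain a b (k - (D - 1)))
    = of_int (step_coeff a b (k + D)) *\<^sub>R (chain a b (k + D) + chain a b (k - D))" for D
  proof -
    have args: "k + (D + 1) = k + D + 1" "k - (D + 1) = k - D - 1"
        "k + (D - 1) = k + D - 1" "k - (D - 1) = k - D + 1"
      by simp_all
    have "step_coeff a b (k - D) = step_coeff a b (k + D)" by (simp add: step_coeff_def)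
    then show ?thesis
      unfolding args scaleR_add_right
      unfolding chain_step[of a b "k + D", symmetric]
        chain_step[of a b "k - D", symmetric, unfolded \<open>step_coeff a b (k - D) = _\<close>]
      by (simp only: ac_simps)
  qed
  have coeff: "of_int (chain_coeff a b k (D + 1)) *\<^sub>R chain a b k
      + of_int (chain_coeff a b k (D - 1)) *\<^sub>R chain a b k
    = of_int (step_coeff a b (k + D)) *\<^sub>R of_int (chain_coeff a b k D) *\<^sub>R chain a b k" for D
    using chain_coeff_step[of a b k D] by (simp flip: scaleR_add_left of_int_add of_int_mult)
  {
    case (3 D)
    then show ?case using sum[of D] coeff[of D] by (metis add_right_cancel)
  next
    case (4 D)
    then show ?case using sum[of D] coeff[of D] by (metis add_left_cancel)
  }
qed

lemma chain_base: "chain a b 0 = alpha1" "chain a b (- 1) = - alpha2"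
  using eta_add_eta[of a b 0]
  by (simp_all add: chain_def alpha1_def alpha2_def eta_def gamma_def)

text \<open>
  Consecutive roots form a positively oriented lattice basis.  Unlike the form, which is degenerate
  for \<open>ab = 4\<close>, this determinant detects linear independence in all cases.
\<close>

lemma chain_det:
  "fst (chain a b k) * snd (chain a b (k + 1)) - snd (chain a b k) * fst (chain a b (k + 1)) = 1"
proof (induction k rule: int_induct[where k = 0])
  case base
  then show ?case by (simp add: chain_def eta_def gamma_def)
next
  case (step1 i)
  have next_root: "chain a b (i + 1 + 1) = of_int (step_coeff a b (i + 1)) *\<^sub>R chain a b (i + 1) - chain a b i"
    using chain_step[of a b "i + 1"] by (simp add: eq_diff_eq)
  show ?case unfolding next_root using step1(2) by (simp add: ring_distribs mult.commute)
next
  case (step2 i)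
  have prev_root: "chain a b (i - 1) = of_int (step_coeff a b i) *\<^sub>R chain a b i - chain a b (i + 1)"
    using chain_step[of a b i] by (simp add: algebra_simps)
  show ?case unfolding prev_root using step2(2) by (simp add: ring_distribs mult.commute)
qed

text \<open>
  The coefficients \<open>x\<^sub>m\<close> of \<open>g\<^sub>m\<close> with respect to \<open>g\<^sub>1\<close> need not grow: for \<open>n = 1, 4, 1, 4, \<dots>\<close> they are
  \<open>1, 1, 3, 2, 5, \<dots>\<close> or \<open>1, 4, 3, 8, \<dots>\<close>.  What persists is the weighted inequality
  \<open>n\<^bsub>m+1\<^esub> x\<^bsub>m+1\<^esub> \<ge> 2 x\<^sub>m\<close>, because \<open>n\<^bsub>m+1\<^esub> n\<^bsub>m+2\<^esub> \<ge> 4\<close>; the same holds for the coefficients of \<open>-g\<^sub>0\<close>.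
\<close>

lemma chain_positive_combination:
  fixes g :: "nat \<Rightarrow> rvec" and n :: "nat \<Rightarrow> int"
  assumes rec: "\<And>m. g (Suc (Suc m)) = of_int (n (Suc m)) *\<^sub>R g (Suc m) - g m"
    and pos: "\<And>m. n m > 0" and ge4: "\<And>m. n m * n (Suc m) \<ge> 4"
  shows "\<exists>x y. 0 < x \<and> 0 \<le> y \<and> g (Suc m) = of_int x *\<^sub>R g 1 - of_int y *\<^sub>R g 0"
proof -
  have step: "2 * x' \<le> q * (p * x' - x)"
    if "2 * x \<le> p * x'" "0 \<le> x'" "0 < q" "4 \<le> p * q" for p q x x' :: int
  proof -
    have "4 * x' \<le> (p * q) * x'" using that by (intro mult_right_mono) auto
    also have "\<dots> \<le> q * (2 * (p * x') - 2 * x)"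
      using mult_left_mono[OF that(1), of q] that(3) by (simp add: algebra_simps)
    finally show ?thesis by (simp add: algebra_simps)
  qed
  have "\<exists>x y x' y'. 0 < x \<and> 0 \<le> y \<and> 0 < x' \<and> 0 \<le> y'
      \<and> 2 * x \<le> n (Suc (Suc m)) * x' \<and> 2 * y \<le> n (Suc (Suc m)) * y'
      \<and> g (Suc m) = of_int x *\<^sub>R g 1 - of_int y *\<^sub>R g 0
      \<and> g (Suc (Suc m)) = of_int x' *\<^sub>R g 1 - of_int y' *\<^sub>R g 0"
  proof (induction m)
    case 0
    show ?case
      using rec[of 0] pos[of 1] pos[of 2] ge4[of 1]
      by (intro exI[of _ 1] exI[of _ 0] exI[of _ "n 1"] exI[of _ 1])
        (simp add: numeral_2_eq_2 mult.commute)
  next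
    case (Suc m)
    then obtain x y x' y' where *: "0 < x" "0 \<le> y" "0 < x'" "0 \<le> y'"
      "2 * x \<le> n (Suc (Suc m)) * x'" "2 * y \<le> n (Suc (Suc m)) * y'"
      "g (Suc m) = of_int x *\<^sub>R g 1 - of_int y *\<^sub>R g 0"
      "g (Suc (Suc m)) = of_int x' *\<^sub>R g 1 - of_int y' *\<^sub>R g 0"
      by blast
    define p q where "p = n (Suc (Suc m))" and "q = n (Suc (Suc (Suc m)))"
    have q: "0 < q" "4 \<le> p * q" using pos ge4 by (simp_all add: p_def q_def)
    have x: "2 * x' \<le> q * (p * x' - x)" and y: "2 * y' \<le> q * (p * y' - y)"
      using * q by (auto intro!: step simp: p_def)
    have "0 < q * (p * x' - x)" "0 \<le> q * (p * y' - y)" using x y * by linarith+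
    then have "0 < p * x' - x" "0 \<le> p * y' - y"
      using q(1) by (simp_all add: zero_less_mult_iff zero_le_mult_iff)
    moreover have "g (Suc (Suc (Suc m)))
        = of_int (p * x' - x) *\<^sub>R g 1 - of_int (p * y' - y) *\<^sub>R g 0"
      unfolding rec[of "Suc m"] *(7,8) by (simp add: p_def algebra_simps)
    ultimately show ?case using * x y unfolding q_def by blast
  qed
  then show ?thesis by blast
qed

section \<open>Reflection-closed sets of indices\<close>

definition refl_closed :: "int set \<Rightarrow> bool" where
  "refl_closed K \<longleftrightarrow> (\<forall>j\<in>K. \<forall>k\<in>K. 2 * k - j \<in> K)"

lemma refl_closed_progression:
  assumes K: "refl_closed K" and p: "p \<in> K" and q: "p + D \<in> K"
  shows "p + m * D \<in> K"
proof (induction m rule: int_two_step_induct)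
  case 1
  then show ?case using p by simp
next
  case 2
  then show ?case using q by simp
next
  case (3 m)
  then have "2 * (p + m * D) - (p + (m - 1) * D) \<in> K" using K unfolding refl_closed_def by blast
  then show ?case by (simp add: algebra_simps)
next
  case (4 m)
  then have "2 * (p + m * D) - (p + (m + 1) * D) \<in> K" using K unfolding refl_closed_def by blast
  then show ?case by (simp add: algebra_simps)
qed

text \<open>
  Two elements of \<open>K\<close> at the least distance \<open>D\<close> generate a progression inside \<open>K\<close>.  An element off
  the progression would be nearer than \<open>D\<close> to one on it.
\<close>

lemma refl_closed_cases:
  assumes K: "refl_closed K" and "K \<noteq> {}"
  obtains p where "K = {p}" | p D where "D > 0" "K = range (\<lambda>m. p + m * D)"
proof -
  obtain p0 where p0: "p0 \<in> K" using assms(2) by auto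
  show ?thesis
  proof (cases "K = {p0}")
    case True
    then show ?thesis using that(1) by blast
  next
    case False
    define gap where "gap n \<longleftrightarrow> 0 < n \<and> (\<exists>p\<in>K. p + int n \<in> K)" for n
    obtain q0 where "q0 \<in> K" "q0 \<noteq> p0" using False p0 by auto
    then have "gap (nat \<bar>q0 - p0\<bar>)"
      using p0 unfolding gap_def by (cases "p0 < q0") (force intro: bexI[of _ p0] bexI[of _ q0])+
    then have least: "gap (LEAST n. gap n)" "\<And>n. gap n \<Longrightarrow> (LEAST n. gap n) \<le> n"
      by (auto intro: LeastI Least_le)
    define D where "D = int (LEAST n. gap n)"
    obtain p where p: "p \<in> K" "p + D \<in> K" and D: "D > 0"
      using least(1) unfolding gap_def D_def by auto
    have prog: "p + m * D \<in> K" for m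
      using refl_closed_progression[OF K p] .
    have "x \<in> range (\<lambda>m. p + m * D)" if x: "x \<in> K" for x
    proof -
      define y where "y = p + (x - p) div D * D"
      have x_eq: "x = y + (x - p) mod D" by (simp add: y_def)
      have "y \<in> K" unfolding y_def by (rule prog)
      have "\<not> gap (nat ((x - p) mod D))"
      proof
        assume "gap (nat ((x - p) mod D))"
        then have "D \<le> (x - p) mod D"
          using least(2) pos_mod_sign[OF D, of "x - p"] unfolding D_def by fastforce
        then show False using pos_mod_bound[OF D, of "x - p"] by simp
      qed
      then have "(x - p) mod D = 0"
        using \<open>y \<in> K\<close> x x_eq pos_mod_sign[OF D, of "x - p"] unfolding gap_def
        by (metis int_nat_eq order_le_less zero_less_nat_eq)
      then show ?thesis using x_eq unfolding y_def by auto
    qed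
    then have "K = range (\<lambda>m. p + m * D)" using prog by auto
    then show ?thesis using that(2) D by blast
  qed
qed

section \<open>The subsystems and their simple roots\<close>

definition signed_chain :: "int \<Rightarrow> int \<Rightarrow> int set \<Rightarrow> rvec set" where
  "signed_chain a b K = {v. \<exists>k\<in>K. v = chain a b k \<or> v = - chain a b k}"

lemma simple_roots_pair_iff:
  "simple_roots a b \<Psi> [x, y] \<longleftrightarrow>
    x \<in> \<Psi> \<and> y \<in> \<Psi> \<and> x \<noteq> y \<and> independent {x, y} \<and> \<Psi> = Phi a b {x, y} \<and>
    (\<forall>\<beta>\<in>\<Psi>. \<exists>m n :: int. \<beta> = of_int m *\<^sub>R x + of_int n *\<^sub>R y \<and> (0 \<le> m \<and> 0 \<le> n \<or> m \<le> 0 \<and> n \<le> 0))"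
proof -
  have "(\<exists>c :: nat \<Rightarrow> int. \<beta> = (\<Sum>i<2. of_int (c i) *\<^sub>R [x, y] ! i) \<and>
        ((\<forall>i<2. 0 \<le> c i) \<or> (\<forall>i<2. c i \<le> 0)))
    \<longleftrightarrow> (\<exists>m n :: int. \<beta> = of_int m *\<^sub>R x + of_int n *\<^sub>R y \<and> (0 \<le> m \<and> 0 \<le> n \<or> m \<le> 0 \<and> n \<le> 0))"
    (is "?L \<longleftrightarrow> ?R") for \<beta>
  proof
    assume ?L
    then obtain c :: "nat \<Rightarrow> int" where "\<beta> = (\<Sum>i<2. of_int (c i) *\<^sub>R [x, y] ! i)"
      "(\<forall>i<2. 0 \<le> c i) \<or> (\<forall>i<2. c i \<le> 0)" by blast
    then show ?R
      by (intro exI[of _ "c 0"] exI[of _ "c 1"]) (auto simp: numeral_2_eq_2)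
  next
    assume ?R
    then obtain m n :: int where "\<beta> = of_int m *\<^sub>R x + of_int n *\<^sub>R y"
      "0 \<le> m \<and> 0 \<le> n \<or> m \<le> 0 \<and> n \<le> 0" by blast
    then show ?L
      by (intro exI[of _ "\<lambda>i. if i = 0 then m else n"]) (auto simp: numeral_2_eq_2)
  qed
  then show ?thesis
    unfolding simple_roots_def by (simp add: numeral_2_eq_2[symmetric])
qed

lemma simple_roots_swap: "simple_roots a b \<Psi> [x, y] \<Longrightarrow> simple_roots a b \<Psi> [y, x]"
  unfolding simple_roots_pair_iff insert_commute[of y x] by (metis add.commute)

lemma independent_pair_det:
  fixes x y :: rvec
  assumes det: "fst x * snd y - snd x * fst y \<noteq> 0"
  shows "independent {x, y}"
proof -
  have "y \<noteq> 0" using det by (auto simp: zero_prod_def)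
  moreover have "x \<notin> span {y}" using det by (auto simp: span_singleton)
  ultimately show ?thesis by (simp add: independent_insert)
qed

lemma cartan_mat_single: "cartan_mat a b [x] = mat_of_rows_list 1 [[2 * ip a b x x / ip a b x x]]"
  and ip_mat_single: "ip_mat a b [x] = mat_of_rows_list 1 [[ip a b x x]]"
  by (auto simp: cartan_mat_def ip_mat_def mat_of_rows_list_def)

lemma cartan_mat_pair: "cartan_mat a b [x, y] = mat_of_rows_list 2
      [[2 * ip a b x x / ip a b x x, 2 * ip a b x y / ip a b x x],
       [2 * ip a b y x / ip a b y y, 2 * ip a b y y / ip a b y y]]"
  and ip_mat_pair: "ip_mat a b [x, y] = mat_of_rows_list 2
      [[ip a b x x, ip a b x y], [ip a b y x, ip a b y y]]"
  by (rule eq_matI;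
      auto simp: cartan_mat_def ip_mat_def mat_of_rows_list_def less_Suc_eq numeral_2_eq_2)+

lemma smult_mat_of_rows_list_single:
  "c \<cdot>\<^sub>m mat_of_rows_list 1 [[x]] = mat_of_rows_list 1 [[c * x]]"
  by (auto simp: mat_of_rows_list_def)

lemma smult_mat_of_rows_list_pair:
  "c \<cdot>\<^sub>m mat_of_rows_list 2 [[x, y], [z, w]] = mat_of_rows_list 2 [[c * x, c * y], [c * z, c * w]]"
  by (rule eq_matI; auto simp: mat_of_rows_list_def less_Suc_eq numeral_2_eq_2)

definition norm_sq :: "int \<Rightarrow> int \<Rightarrow> int \<Rightarrow> real" where
  "norm_sq a b k = (if even k then 2 * of_int a / of_int b else 2)"

locale infinite_rank2 =
  fixes a b :: int
  assumes a_pos: "a > 0" and b_pos: "b > 0" and ab_ge_4: "a * b \<ge> 4"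
begin

lemma b_nonzero: "b \<noteq> 0"
  using b_pos by simp

lemma norm_sq_pos: "norm_sq a b k > 0"
  using a_pos b_pos by (simp add: norm_sq_def)

lemma norm_sq_step: "norm_sq a b k * of_int (step_coeff a b k) = 2 * of_int a"
  using b_pos by (simp add: norm_sq_def step_coeff_def)

text \<open>
  The Gram matrix of two consecutive roots is carried along the chain: as \<open>\<beta>\<^bsub>k+2\<^esub> = s \<beta>\<^bsub>k+1\<^esub> - \<beta>\<^sub>k\<close> and
  \<open>s (\<beta>\<^bsub>k+1\<^esub>, \<beta>\<^bsub>k+1\<^esub>) = 2a\<close>, the new product is \<open>2a - a = a\<close> and the new norm equals that of \<open>\<beta>\<^sub>k\<close>.
\<close>

lemma ip_chain_adjacent:
  "ip a b (chain a b k) (chain a b k) = norm_sq a b k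
    \<and> ip a b (chain a b k) (chain a b (k + 1)) = of_int a
    \<and> ip a b (chain a b (k + 1)) (chain a b (k + 1)) = norm_sq a b (k + 1)"
proof -
  have step: "ip a b y (s *\<^sub>R y - x) = of_int a"
    "ip a b (s *\<^sub>R y - x) (s *\<^sub>R y - x) = ip a b x x"
    if "ip a b x y = of_int a" "ip a b y y * s = 2 * of_int a" for x y s
  proof -
    have "ip a b y x = of_int a" "s * ip a b y y = 2 * of_int a"
      using that by (simp_all add: ip_commute[of a b y x] mult.commute)
    then show "ip a b y (s *\<^sub>R y - x) = of_int a"
      "ip a b (s *\<^sub>R y - x) (s *\<^sub>R y - x) = ip a b x x"
      using that by (simp_all add: ip_simps[OF b_nonzero])
  qed
  show ?thesis
  proof (induction k rule: int_induct[where k = 0])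
    case base
    then show ?case
      using b_pos
      by (simp add: chain_def eta_def gamma_def norm_sq_def ip_def B_mat_def mat_of_rows_list_def)
  next
    case (step1 i)
    have root: "chain a b (i + 1 + 1)
        = of_int (step_coeff a b (i + 1)) *\<^sub>R chain a b (i + 1) - chain a b i"
      using chain_step[of a b "i + 1"] by (simp add: eq_diff_eq)
    have "norm_sq a b (i + 1 + 1) = norm_sq a b i" by (simp add: norm_sq_def)
    show ?case
      unfolding root \<open>norm_sq a b (i + 1 + 1) = _\<close>
      using step1 step[of "chain a b i" "chain a b (i + 1)" "of_int (step_coeff a b (i + 1))"]
        norm_sq_step[of "i + 1"] by simp
  next
    case (step2 i)
    have root: "chain a b (i - 1) = of_int (step_coeff a b i) *\<^sub>R chain a b i - chain a b (i + 1)"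
      using chain_step[of a b i] by (simp add: eq_diff_eq add.commute)
    have "norm_sq a b (i - 1) = norm_sq a b (i + 1)" by (simp add: norm_sq_def)
    moreover have "ip a b (chain a b i) (chain a b (i - 1)) = of_int a"
      "ip a b (chain a b (i - 1)) (chain a b (i - 1)) = norm_sq a b (i + 1)"
      using step2 step[of "chain a b (i + 1)" "chain a b i" "of_int (step_coeff a b i)"]
        norm_sq_step[of i] ip_commute[of a b "chain a b i" "chain a b (i + 1)"]
      unfolding root by simp_all
    ultimately show ?case
      using step2 ip_commute[of a b "chain a b i" "chain a b (i - 1)"] by simp
  qed
qed

lemma ip_chain_self: "ip a b (chain a b k) (chain a b k) = norm_sq a b k"
  using ip_chain_adjacent by blast

lemma ip_chain:
  "ip a b (chain a b k) (chain a b (k + D)) = norm_sq a b k / 2 * of_int (chain_coeff a b k D)"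
proof (induction D rule: int_two_step_induct)
  case 1
  then show ?case by (simp add: ip_chain_self chain_coeff_0)
next
  case 2
  then show ?case using ip_chain_adjacent[of k] norm_sq_step[of k] by (simp add: chain_coeff_1)
next
  have sum: "ip a b (chain a b k) (chain a b (k + (D + 1))) + ip a b (chain a b k) (chain a b (k + (D - 1)))
    = of_int (step_coeff a b (k + D)) * ip a b (chain a b k) (chain a b (k + D))" for D
  proof -
    have root: "chain a b (k + (D + 1))
        = of_int (step_coeff a b (k + D)) *\<^sub>R chain a b (k + D) - chain a b (k + (D - 1))"
      using chain_step[of a b "k + D"] by (simp add: eq_diff_eq algebra_simps)
    show ?thesis unfolding root by (simp add: ip_simps[OF b_nonzero])
  qed
  have coeff: "of_int (chain_coeff a b k (D + 1)) + of_int (chain_coeff a b k (D - 1))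
    = (of_int (step_coeff a b (k + D)) * of_int (chain_coeff a b k D) :: real)" for D
    using chain_coeff_step[of a b k D] by (simp flip: of_int_add of_int_mult)
  have eq: "norm_sq a b k / 2 * of_int (chain_coeff a b k (D + 1))
      + norm_sq a b k / 2 * of_int (chain_coeff a b k (D - 1))
    = of_int (step_coeff a b (k + D)) * (norm_sq a b k / 2 * of_int (chain_coeff a b k D))" for D
    using coeff[of D] by (simp flip: distrib_left)
  {
    case (3 D)
    then show ?case using sum[of D] eq[of D] by (metis add_right_cancel)
  next
    case (4 D)
    then show ?case using sum[of D] eq[of D] by (metis add_left_cancel)
  }
qed

lemma refl_root_chain: "refl_root a b (chain a b k) (chain a b j) = - chain a b (2 * k - j)"
proof -
  have "2 * ip a b (chain a b j) (chain a b k) / ip a b (chain a b k) (chain a b k)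
      = of_int (chain_coeff a b k (j - k))"
    using ip_chain[of k "j - k"] norm_sq_pos[of k]
    by (simp add: ip_chain_self ip_commute[of a b "chain a b j" "chain a b k"] field_simps)
  then show ?thesis
    using chain_add[of a b k "j - k"] by (simp add: refl_root_def algebra_simps)
qed

text \<open>
  Since \<open>w\<^sub>1\<close> and \<open>w\<^sub>2\<close> are the reflections of the line in \<open>0\<close> and \<open>-1\<close>, the product \<open>w\<^sub>1w\<^sub>2\<close> moves the
  chain by \<open>2\<close> and \<open>w\<^sub>2w\<^sub>1\<close> moves it by \<open>-2\<close>.
\<close>

lemma alphas_eq_chain:
  "alphaLL a b j = chain a b (2 * j)"
  "alphaLU a b j = - chain a b (- 2 * j - 2)"
  "alphaSU a b j = - chain a b (- 2 * j - 1)"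
  "alphaSL a b j = chain a b (2 * j + 1)"
proof -
  have w1: "w1 b (chain a b k) = - chain a b (- k)" and w2: "w2 a (chain a b k) = - chain a b (- 2 - k)" for k
    using refl_root_simple[OF a_pos b_pos] refl_root_chain[of 0 k] refl_root_chain[of "- 1" k]
      refl_root_uminus[OF b_nonzero, of a "alpha2"] by (simp_all add: chain_base)
  have uminus: "w1 b (- x) = - w1 b x" "w2 a (- x) = - w2 a x" for x
    by (simp_all add: w1_def w2_def)
  have comp: "w1 b \<circ> w2 a \<in> carrier Sym" "w2 a \<circ> w1 b \<in> carrier Sym"
    using group.subgroup_self[OF group_BijGroup] w1_in_Sym w2_in_Sym
    by (metis Sym_mult group.is_monoid group_BijGroup monoid.m_closed)+
  have t: "((w1 b \<circ> w2 a) [^]\<^bsub>Sym\<^esub> j) (chain a b k) = chain a b (k + 2 * j)" for k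
    by (rule Sym_pow_shift[OF comp(1)]) (simp add: w1 w2 uminus)
  have u: "((w2 a \<circ> w1 b) [^]\<^bsub>Sym\<^esub> j) (- chain a b k) = - chain a b (- 2 * j + k)" for k
    using Sym_pow_shift[OF comp(2), where F = "\<lambda>k. - chain a b k" and m = "- 2", of j k]
    by (simp add: w1 w2 uminus add.commute)
  have simple: "alpha1 = chain a b 0" "alpha2 = - chain a b (- 1)"
    by (simp_all add: chain_base)
  show "alphaLL a b j = chain a b (2 * j)" "alphaSL a b j = chain a b (2 * j + 1)"
    unfolding alphaLL_def alphaSL_def simple uminus w1 by (simp_all add: t add.commute)
  show "alphaLU a b j = - chain a b (- 2 * j - 2)" "alphaSU a b j = - chain a b (- 2 * j - 1)"
    unfolding diff_conv_add_uminus
    unfolding alphaLU_def alphaSU_def simple w2 by (simp_all add: u)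
qed

lemma signed_chain_anisotropic:
  assumes "\<gamma> \<in> signed_chain a b K"
  shows "ip a b \<gamma> \<gamma> \<noteq> 0"
proof -
  obtain k where "\<gamma> = chain a b k \<or> \<gamma> = - chain a b k"
    using assms unfolding signed_chain_def by blast
  then have "ip a b \<gamma> \<gamma> = norm_sq a b k"
    by (auto simp: ip_simps[OF b_nonzero] ip_chain_self)
  then show ?thesis using norm_sq_pos[of k] by simp
qed

lemma refl_root_signed_chain:
  assumes K: "refl_closed K" and "\<gamma> \<in> signed_chain a b K" "\<beta> \<in> signed_chain a b K"
  shows "refl_root a b \<gamma> \<beta> \<in> signed_chain a b K"
proof -
  obtain k j where "k \<in> K" "\<gamma> = chain a b k \<or> \<gamma> = - chain a b k"
    "j \<in> K" "\<beta> = chain a b j \<or> \<beta> = - chain a b j"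
    using assms(2,3) unfolding signed_chain_def by blast
  moreover from this have "2 * k - j \<in> K" using K unfolding refl_closed_def by blast
  ultimately show ?thesis
    unfolding signed_chain_def
    by (auto simp: refl_root_uminus[OF b_nonzero] refl_root_linear[OF b_nonzero] refl_root_chain)
qed

lemma Phi_subset_signed_chain:
  assumes "refl_closed K" "\<Gamma> \<subseteq> signed_chain a b K"
  shows "Phi a b \<Gamma> \<subseteq> signed_chain a b K"
proof (rule Phi_minimal[OF b_nonzero])
  show "\<forall>\<gamma>\<in>\<Gamma>. ip a b \<gamma> \<gamma> \<noteq> 0"
    using assms(2) signed_chain_anisotropic by blast
  show "refl_root a b \<gamma> \<beta> \<in> signed_chain a b K"
    if "\<gamma> \<in> \<Gamma>" "\<beta> \<in> signed_chain a b K" for \<gamma> \<beta>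
    using assms that by (blast intro: refl_root_signed_chain)
qed (fact assms(2))

lemma Phi_eq_signed_chain:
  assumes \<Gamma>: "\<Gamma> \<subseteq> signed_chain a b UNIV"
  shows "refl_closed {k. chain a b k \<in> Phi a b \<Gamma>}"
    and "Phi a b \<Gamma> = signed_chain a b {k. chain a b k \<in> Phi a b \<Gamma>}"
proof -
  have anisotropic: "\<forall>\<gamma>\<in>\<Gamma>. ip a b \<gamma> \<gamma> \<noteq> 0"
    using \<Gamma> signed_chain_anisotropic by blast
  note closed = Phi_closed[OF b_nonzero anisotropic] and neg = Phi_uminus[OF b_nonzero anisotropic]
  show "refl_closed {k. chain a b k \<in> Phi a b \<Gamma>}"
    unfolding refl_closed_def
  proof (intro ballI CollectI)
    fix j k assume "j \<in> {k. chain a b k \<in> Phi a b \<Gamma>}" "k \<in> {k. chain a b k \<in> Phi a b \<Gamma>}"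
    then have "- refl_root a b (chain a b k) (chain a b j) \<in> Phi a b \<Gamma>"
      by (intro neg closed) auto
    then show "chain a b (2 * k - j) \<in> Phi a b \<Gamma>" by (simp add: refl_root_chain)
  qed
  have "refl_closed UNIV" by (simp add: refl_closed_def)
  then have "Phi a b \<Gamma> \<subseteq> signed_chain a b UNIV" using \<Gamma> by (rule Phi_subset_signed_chain)
  then show "Phi a b \<Gamma> = signed_chain a b {k. chain a b k \<in> Phi a b \<Gamma>}"
    using neg unfolding signed_chain_def by (fastforce simp del: split_paired_Ex split_paired_All)
qed

lemma real_roots_subset: "real_roots a b \<subseteq> signed_chain a b UNIV"
proof -
  have "Weyl a b = W_sub a b {alpha1, alpha2}"
    by (simp add: Weyl_def W_sub_def refl_root_simple[OF a_pos b_pos])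
  then have "real_roots a b \<subseteq> Phi a b {alpha1, alpha2}"
    by (auto simp: real_roots_def Phi_def orbit_set_def)
  also have "\<dots> \<subseteq> signed_chain a b UNIV"
  proof (rule Phi_subset_signed_chain)
    have "alpha1 = chain a b 0" "alpha2 = - chain a b (- 1)" by (simp_all add: chain_base)
    then show "{alpha1, alpha2} \<subseteq> signed_chain a b UNIV" unfolding signed_chain_def by blast
  qed (simp add: refl_closed_def)
  finally show ?thesis .
qed

lemma Phi_chain_pair:
  "Phi a b {chain a b (p + D), - chain a b p} = signed_chain a b (range (\<lambda>m. p + m * D))"
    (is "Phi a b ?\<Gamma> = signed_chain a b ?K")
proof
  have \<Gamma>: "?\<Gamma> \<subseteq> signed_chain a b ?K"
  proof -
    have "p \<in> ?K" "p + D \<in> ?K"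
      using rangeI[of "\<lambda>m. p + m * D" 0] rangeI[of "\<lambda>m. p + m * D" 1] by simp_all
    then show ?thesis unfolding signed_chain_def by blast
  qed
  have "refl_closed ?K"
    unfolding refl_closed_def
  proof (intro ballI)
    fix j k assume "j \<in> ?K" "k \<in> ?K"
    then obtain m n where "j = p + m * D" "k = p + n * D" by auto
    then show "2 * k - j \<in> ?K" by (intro range_eqI[of _ _ "2 * n - m"]) (simp add: algebra_simps)
  qed
  then show "Phi a b ?\<Gamma> \<subseteq> signed_chain a b ?K" using \<Gamma> by (rule Phi_subset_signed_chain)
  have \<Gamma>': "?\<Gamma> \<subseteq> signed_chain a b UNIV" unfolding signed_chain_def by blast
  let ?K' = "{k. chain a b k \<in> Phi a b ?\<Gamma>}"
  have "?\<Gamma> \<subseteq> Phi a b ?\<Gamma>" by (rule Phi_incl)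
  moreover have "- (- chain a b p) \<in> Phi a b ?\<Gamma>"
    by (rule Phi_uminus[OF b_nonzero]) (use \<Gamma>' signed_chain_anisotropic \<open>?\<Gamma> \<subseteq> Phi a b ?\<Gamma>\<close> in blast)+
  ultimately have "p \<in> ?K'" "p + D \<in> ?K'" by auto
  then have "?K \<subseteq> ?K'"
    using refl_closed_progression[OF Phi_eq_signed_chain(1)[OF \<Gamma>']] by blast
  then have "signed_chain a b ?K \<subseteq> signed_chain a b ?K'" unfolding signed_chain_def by blast
  then show "signed_chain a b ?K \<subseteq> Phi a b ?\<Gamma>"
    using Phi_eq_signed_chain(2)[OF \<Gamma>'] by blast
qed

lemma Phi_single:
  assumes "x \<in> signed_chain a b UNIV"
  shows "Phi a b {x} = {x, - x}"
proof
  have x: "ip a b x x \<noteq> 0" using assms by (rule signed_chain_anisotropic)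
  show "Phi a b {x} \<subseteq> {x, - x}"
  proof (rule Phi_minimal[OF b_nonzero])
    have "refl_root a b x x = - x" "refl_root a b x (- x) = x"
      using x by (simp_all add: refl_root_self refl_root_linear[OF b_nonzero])
    then show "refl_root a b \<gamma> \<beta> \<in> {x, - x}" if "\<gamma> \<in> {x}" "\<beta> \<in> {x, - x}" for \<gamma> \<beta>
      using that by (elim insertE emptyE) simp_all
  qed (use x in auto)
  have "x \<in> Phi a b {x}" using Phi_incl by blast
  moreover have "- x \<in> Phi a b {x}"
    by (rule Phi_uminus[OF b_nonzero]) (use x Phi_incl in auto)
  ultimately show "{x, - x} \<subseteq> Phi a b {x}" by simp
qed

lemma chain_coeff_pos: "D > 0 \<Longrightarrow> chain_coeff a b k D > 0"
  using delta_ge_2[OF ab_ge_4, of "D div 2"] epsilon_ge_1[OF ab_ge_4, of "D div 2"] a_pos b_pos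
  by (auto simp: chain_coeff_def step_coeff_def)

lemma chain_coeff_mult_ge_4:
  assumes D: "D > 0"
  shows "chain_coeff a b j D * chain_coeff a b (j + D) D \<ge> 4"
    and "chain_coeff a b (j + D) D * chain_coeff a b j D \<ge> 4"
proof -
  show "chain_coeff a b j D * chain_coeff a b (j + D) D \<ge> 4"
  proof (cases "even D")
    case True
    then have "2 \<le> delta a b (D div 2)" using D by (intro delta_ge_2 ab_ge_4) auto
    then have "2 * 2 \<le> delta a b (D div 2) * delta a b (D div 2)" by (intro mult_mono) auto
    then show ?thesis using True by (simp add: chain_coeff_def)
  next
    case False
    have e: "1 \<le> epsilon a b (D div 2)" using D by (intro epsilon_ge_1 ab_ge_4) auto
    then have "1 * 1 \<le> epsilon a b (D div 2) * epsilon a b (D div 2)" by (intro mult_mono) auto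
    then have "4 * 1 \<le> (a * b) * (epsilon a b (D div 2) * epsilon a b (D div 2))"
      using ab_ge_4 by (intro mult_mono) auto
    then show ?thesis using False by (auto simp: chain_coeff_def step_coeff_def mult_ac)
  qed
  then show "chain_coeff a b (j + D) D * chain_coeff a b j D \<ge> 4" by (simp add: mult.commute)
qed

text \<open>
  The two values of \<open>c\<close> are the two directions in which a progression can be followed.
\<close>

lemma chain_progression_combination:
  assumes D: "D > 0" and c: "c = 1 \<or> c = - 1"
  shows "\<exists>x y. 0 < x \<and> 0 \<le> y \<and> chain a b (q + int (Suc m) * (c * D))
    = of_int x *\<^sub>R chain a b (q + c * D) - of_int y *\<^sub>R chain a b q"
proof -
  define g where "g m = chain a b (q + int m * (c * D))" for m
  define n where "n m = chain_coeff a b (q + int m * (c * D)) D" for m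
  have "\<exists>x y. 0 < x \<and> 0 \<le> y \<and> g (Suc m) = of_int x *\<^sub>R g 1 - of_int y *\<^sub>R g 0"
  proof (rule chain_positive_combination[of g n])
    fix m
    let ?k = "q + int (Suc m) * (c * D)"
    have "g (Suc (Suc m)) = chain a b (?k + c * D)" "g m = chain a b (?k - c * D)"
      by (simp_all add: g_def algebra_simps)
    then have "g (Suc (Suc m)) + g m = of_int (n (Suc m)) *\<^sub>R g (Suc m)"
      using chain_add[of a b ?k D] c by (auto simp: g_def n_def add.commute)
    then show "g (Suc (Suc m)) = of_int (n (Suc m)) *\<^sub>R g (Suc m) - g m"
      by (simp add: eq_diff_eq)
    show "n m > 0" unfolding n_def using D by (rule chain_coeff_pos)
    show "n m * n (Suc m) \<ge> 4"
      using c chain_coeff_mult_ge_4(1)[OF D, of "q + int m * D"]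
        chain_coeff_mult_ge_4(2)[OF D, of "q - int (Suc m) * D"]
      by (auto simp: n_def algebra_simps)
  qed
  then show ?thesis by (simp add: g_def)
qed

lemma chain_det_pos:
  assumes D: "D > 0"
  shows "fst (chain a b p) * snd (chain a b (p + D)) - snd (chain a b p) * fst (chain a b (p + D)) > 0"
proof -
  \<comment> \<open>Only the coefficient of \<open>\<beta>\<^bsub>p+1\<^esub>\<close> in \<open>\<beta>\<^bsub>p+D\<^esub>\<close> contributes, and it is positive.\<close>
  define m where "m = nat (D - 1)"
  have m: "p + D = p + int (Suc m) * (1 * 1)" using D by (simp add: m_def)
  obtain x y where x: "0 < x" and eq:
    "chain a b (p + D) = of_int x *\<^sub>R chain a b (p + 1 * 1) - of_int y *\<^sub>R chain a b p"
    unfolding m using chain_progression_combination[of 1 1 p m] by auto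
  have "fst (chain a b p) * snd (chain a b (p + D)) - snd (chain a b p) * fst (chain a b (p + D))
    = of_int x * (fst (chain a b p) * snd (chain a b (p + 1)) - snd (chain a b p) * fst (chain a b (p + 1)))"
    unfolding eq by (simp add: algebra_simps)
  then show ?thesis using x by (simp add: chain_det)
qed

text \<open>
  Roots of index at least \<open>p + D\<close> are reached by going up from the pair \<open>p, p + D\<close> and are nonnegative
  combinations of \<open>\<beta>\<^bsub>p+D\<^esub>\<close> and \<open>-\<beta>\<^sub>p\<close>; those of index at most \<open>p\<close> are reached by going down, with the
  roles of the two ends exchanged, and are nonpositive combinations.
\<close>

lemma simple_roots_chain_pair:
  assumes D: "D > 0"
  shows "simple_roots a b (signed_chain a b (range (\<lambda>m. p + m * D))) [chain a b (p + D), - chain a b p]"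
proof -
  let ?x = "chain a b (p + D)" and ?y = "- chain a b p"
  let ?\<Psi> = "signed_chain a b (range (\<lambda>m. p + m * D))"
  have \<Psi>: "?\<Psi> = Phi a b {?x, ?y}" by (simp add: Phi_chain_pair)
  have comb: "\<exists>u v :: int. chain a b (p + m * D) = of_int u *\<^sub>R ?x + of_int v *\<^sub>R ?y
      \<and> (0 \<le> u \<and> 0 \<le> v \<or> u \<le> 0 \<and> v \<le> 0)" for m
  proof (cases "m > 0")
    case True
    define n where "n = nat (m - 1)"
    have "p + int (Suc n) * (1 * D) = p + m * D" using True by (simp add: n_def)
    then obtain u v where "0 < u" "0 \<le> v" "chain a b (p + m * D) = of_int u *\<^sub>R ?x - of_int v *\<^sub>R chain a b p"
      using chain_progression_combination[OF D, of 1 p n] by auto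
    then show ?thesis by (intro exI[of _ u] exI[of _ v]) simp
  next
    case False
    define n where "n = nat (- m)"
    have "(p + D) + int (Suc n) * (- 1 * D) = p + m * D" using False by (simp add: n_def algebra_simps)
    moreover have "p + D + - 1 * D = p" by simp
    ultimately obtain u v where "0 < u" "0 \<le> v" "chain a b (p + m * D) = of_int u *\<^sub>R chain a b p - of_int v *\<^sub>R ?x"
      using chain_progression_combination[OF D, of "- 1" "p + D" n] by metis
    then show ?thesis by (intro exI[of _ "- v"] exI[of _ "- u"]) simp
  qed
  have "\<exists>u v :: int. \<beta> = of_int u *\<^sub>R ?x + of_int v *\<^sub>R ?y \<and> (0 \<le> u \<and> 0 \<le> v \<or> u \<le> 0 \<and> v \<le> 0)"
    if \<beta>: "\<beta> \<in> ?\<Psi>" for \<beta>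
  proof -
    obtain m where m: "\<beta> = chain a b (p + m * D) \<or> \<beta> = - chain a b (p + m * D)"
      using \<beta> unfolding signed_chain_def by blast
    obtain u v :: int where uv: "chain a b (p + m * D) = of_int u *\<^sub>R ?x + of_int v *\<^sub>R ?y"
      "0 \<le> u \<and> 0 \<le> v \<or> u \<le> 0 \<and> v \<le> 0" using comb[of m] by blast
    from m show ?thesis
    proof
      assume "\<beta> = - chain a b (p + m * D)"
      then have "\<beta> = of_int (- u) *\<^sub>R ?x + of_int (- v) *\<^sub>R ?y" using uv(1) by simp
      then show ?thesis using uv(2) by (intro exI[of _ "- u"] exI[of _ "- v"]) auto
    qed (use uv in blast)
  qed
  moreover have "fst ?x * snd ?y - snd ?x * fst ?y \<noteq> 0"
    using chain_det_pos[OF D, of p] by (simp add: algebra_simps)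
  then have "independent {?x, ?y}" "?x \<noteq> ?y"
    by (rule independent_pair_det) (use \<open>_ \<noteq> 0\<close> in \<open>metis mult.commute diff_self\<close>)
  ultimately show ?thesis
    using Phi_incl[of "{?x, ?y}" a b] \<Psi>
    unfolding simple_roots_pair_iff by blast
qed

lemma simple_roots_single:
  assumes "x \<in> signed_chain a b UNIV"
  shows "simple_roots a b {x, - x} [x]"
proof -
  have "x \<noteq> 0"
    using signed_chain_anisotropic[OF assms] by (auto simp: ip_def)
  have "\<exists>c :: nat \<Rightarrow> int. \<beta> = (\<Sum>i<1. of_int (c i) *\<^sub>R [x] ! i) \<and> ((\<forall>i<1. 0 \<le> c i) \<or> (\<forall>i<1. c i \<le> 0))"
    if "\<beta> \<in> {x, - x}" for \<beta>
    using that by (intro exI[of _ "\<lambda>_. if \<beta> = x then 1 else - 1"]) auto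
  then show ?thesis
    using \<open>x \<noteq> 0\<close> by (simp add: simple_roots_def Phi_single[OF assms])
qed

lemma has_data_single_long:
  "has_data a b {alphaLL a b r, - alphaLL a b r} [alphaLL a b r] A1_mat ((of_int a / of_int b) \<cdot>\<^sub>m A1_mat)"
proof -
  have "ip a b (alphaLL a b r) (alphaLL a b r) = 2 * of_int a / of_int b"
    by (simp add: alphas_eq_chain ip_chain_self norm_sq_def)
  moreover have "alphaLL a b r \<in> signed_chain a b UNIV"
    unfolding alphas_eq_chain signed_chain_def by blast
  ultimately show ?thesis
    using a_pos b_pos
    by (simp add: has_data_def simple_roots_single cartan_mat_single ip_mat_single A1_mat_def
        smult_mat_of_rows_list_single mult.commute del: One_nat_def)
qed

lemma has_data_single_short:
  "has_data a b {alphaSU a b r, - alphaSU a b r} [alphaSU a b r] A1_mat A1_mat"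
proof -
  have "ip a b (alphaSU a b r) (alphaSU a b r) = 2"
    by (simp add: alphas_eq_chain ip_chain_self norm_sq_def ip_simps[OF b_nonzero])
  moreover have "alphaSU a b r \<in> signed_chain a b UNIV"
    unfolding alphas_eq_chain signed_chain_def by blast
  ultimately show ?thesis
    by (simp add: has_data_def simple_roots_single cartan_mat_single ip_mat_single A1_mat_def)
qed

lemma has_data_pair_long:
  assumes d: "d > 0"
  shows "has_data a b (signed_chain a b (range (\<lambda>m. 2 * r - 2 * d + m * (2 * d))))
    [alphaLL a b r, alphaLU a b (d - r - 1)]
    (H_mat (delta a b d) (delta a b d))
    ((of_int a / of_int b) \<cdot>\<^sub>m H_mat (delta a b d) (delta a b d))"
proof -
  define p q where "p = 2 * r - 2 * d" and "q = p + 2 * d"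
  have roots: "alphaLL a b r = chain a b q" "alphaLU a b (d - r - 1) = - chain a b p"
    by (simp_all add: alphas_eq_chain p_def q_def algebra_simps)
  have p: "even p" "even q" by (simp_all add: p_def q_def)
  have "ip a b (chain a b p) (chain a b q) = of_int a / of_int b * of_int (delta a b d)"
    using ip_chain[of p "2 * d", folded q_def] p by (simp add: norm_sq_def chain_coeff_def)
  then show ?thesis
    unfolding has_data_def roots p_def[symmetric]
    using simple_roots_chain_pair[of "2 * d" p, folded q_def] d a_pos b_pos p
    by (simp add: cartan_mat_pair ip_mat_pair H_mat_def smult_mat_of_rows_list_pair ip_chain_self
        ip_simps[OF b_nonzero] norm_sq_def mult.commute
        ip_commute[of a b "chain a b q" "chain a b p"])
qed

lemma has_data_pair_short:
  assumes d: "d > 0"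
  shows "has_data a b (signed_chain a b (range (\<lambda>m. - 2 * r - 1 + m * (2 * d))))
    [alphaSU a b r, alphaSL a b (d - r - 1)]
    (H_mat (delta a b d) (delta a b d)) (H_mat (delta a b d) (delta a b d))"
proof -
  define p q where "p = - 2 * r - 1" and "q = p + 2 * d"
  have roots: "alphaSU a b r = - chain a b p" "alphaSL a b (d - r - 1) = chain a b q"
    by (simp_all add: alphas_eq_chain p_def q_def algebra_simps)
  have p: "odd p" "odd q" by (simp_all add: p_def q_def)
  have "ip a b (chain a b p) (chain a b q) = of_int (delta a b d)"
    using ip_chain[of p "2 * d", folded q_def] p by (simp add: norm_sq_def chain_coeff_def)
  then show ?thesis
    unfolding has_data_def roots p_def[symmetric]
    using simple_roots_swap[OF simple_roots_chain_pair[of "2 * d" p, folded q_def]] d p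
    by (simp add: cartan_mat_pair ip_mat_pair H_mat_def ip_chain_self
        ip_simps[OF b_nonzero] norm_sq_def mult.commute
        ip_commute[of a b "chain a b q" "chain a b p"])
qed

lemma has_data_pair_mixed:
  assumes d: "d \<ge> 0"
  shows "has_data a b (signed_chain a b (range (\<lambda>m. 2 * r - (2 * d + 1) + m * (2 * d + 1))))
    [alphaLL a b r, alphaSU a b (d - r)]
    (H_mat (a * epsilon a b d) (b * epsilon a b d)) (B_mat (a * epsilon a b d) (b * epsilon a b d))"
proof -
  define p q where "p = 2 * r - (2 * d + 1)" and "q = p + (2 * d + 1)"
  have roots: "alphaLL a b r = chain a b q" "alphaSU a b (d - r) = - chain a b p"
    by (simp_all add: alphas_eq_chain p_def q_def algebra_simps)
  have p: "odd p" "even q" by (simp_all add: p_def q_def)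
  have "ip a b (chain a b p) (chain a b q) = of_int (a * epsilon a b d)"
    using ip_chain[of p "2 * d + 1", folded q_def] p by (simp add: norm_sq_def chain_coeff_def step_coeff_def)
  moreover have "epsilon a b d > 0" using epsilon_ge_1[OF ab_ge_4 d] by simp
  ultimately show ?thesis
    unfolding has_data_def roots p_def[symmetric]
    using simple_roots_chain_pair[of "2 * d + 1" p, folded q_def] d a_pos b_pos p
    by (simp add: cartan_mat_pair ip_mat_pair H_mat_def B_mat_def ip_chain_self
        ip_simps[OF b_nonzero] norm_sq_def mult.commute
        ip_commute[of a b "chain a b q" "chain a b p"])
qed

end

lemma range_progression_shift:
  fixes p D j :: int
  shows "range (\<lambda>m. p + j * D + m * D) = range (\<lambda>m. p + m * D)"
proof
  show "range (\<lambda>m. p + j * D + m * D) \<subseteq> range (\<lambda>m. p + m * D)"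
    by (auto simp: algebra_simps intro!: image_eqI[of _ _ "j + _"])
  have "p + m * D = p + j * D + (m - j) * D" for m by (simp add: algebra_simps)
  then show "range (\<lambda>m. p + m * D) \<subseteq> range (\<lambda>m. p + j * D + m * D)" by (metis image_subsetI rangeI)
qed

text \<open>
  Normal forms of a progression.  For even \<open>D\<close> the parity of its elements is constant and \<open>r\<close> is
  reduced modulo \<open>D / 2\<close>.  For odd \<open>D\<close> both parities occur, so some element is even, and
  \<open>2r\<close> meets every class modulo \<open>D = 2d + 1\<close> exactly once for \<open>-d \<le> r \<le> d\<close>.
\<close>

lemma progression_cases:
  fixes p D :: int
  assumes D: "D > 0"
  obtains
    (even) d r where "D = 2 * d" "d > 0" "0 \<le> r" "r < d"
      "range (\<lambda>m. p + m * D) = range (\<lambda>m. 2 * r - 2 * d + m * D)"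
  | (odd) d r where "D = 2 * d" "d > 0" "0 \<le> r" "r < d"
      "range (\<lambda>m. p + m * D) = range (\<lambda>m. - 2 * r - 1 + m * D)"
  | (mixed) d r where "D = 2 * d + 1" "d \<ge> 0" "- d \<le> r" "r \<le> d"
      "range (\<lambda>m. p + m * D) = range (\<lambda>m. 2 * r - D + m * D)"
proof -
  have shift: "range (\<lambda>m. p + m * D) = range (\<lambda>m. q + m * D)" if "q = p + j * D" for q j
    using range_progression_shift[of p j D] that by simp
  show ?thesis
  proof (cases "even D")
    case True
    then obtain d where d: "D = 2 * d" by auto
    with D have "d > 0" by simp
    show ?thesis
    proof (cases "even p")
      case True
      then obtain s where s: "p = 2 * s" by auto
      have "2 * (s mod d) - 2 * d = p + (- (s div d) - 1) * D"
        by (simp add: s d algebra_simps minus_div_mult_eq_mod[symmetric])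
      from shift[OF this] show ?thesis using d \<open>d > 0\<close> by (intro that(1)[of d "s mod d"]) auto
    next
      case False
      then obtain s where s: "p = 2 * s + 1" by (rule oddE)
      have "- 2 * ((- s - 1) mod d) - 1 = p + ((- s - 1) div d) * D"
        by (simp add: s d algebra_simps minus_div_mult_eq_mod[symmetric])
      from shift[OF this] show ?thesis using d \<open>d > 0\<close> by (intro that(2)[of d "(- s - 1) mod d"]) auto
    qed
  next
    case False
    then obtain d where d: "D = 2 * d + 1" by (rule oddE)
    with D have "d \<ge> 0" by simp
    note mixed = that(3)
    \<comment> \<open>An even element \<open>2s\<close> of the progression determines \<open>r\<close> as the residue of \<open>s\<close> in \<open>{-d..d}\<close>.\<close>
    have *: ?thesis if even_shift: "2 * s = p + j * D" for s j
    proof (rule mixed[of d "(s + d) mod D - d"])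
      have "2 * ((s + d) mod D - d) - D = p + (j - 2 * ((s + d) div D) - 1) * D"
        using even_shift by (simp add: algebra_simps minus_div_mult_eq_mod[symmetric])
      then show "range (\<lambda>m. p + m * D) = range (\<lambda>m. 2 * ((s + d) mod D - d) - D + m * D)" by (rule shift)
      show "- d \<le> (s + d) mod D - d" "(s + d) mod D - d \<le> d"
        using pos_mod_bound[OF D, of "s + d"] pos_mod_sign[OF D, of "s + d"] d by linarith+
    qed (use d \<open>d \<ge> 0\<close> in auto)
    show ?thesis
    proof (cases "even p")
      case True
      then obtain s where "p = 2 * s" by auto
      then show ?thesis by (intro *[of s 0]) simp
    next
      case odd_p: False
      then have "even (p + D)" using False by simp
      then obtain s where "p + D = 2 * s" by (rule evenE)
      then show ?thesis by (intro *[of s 1]) simp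
    qed
  qed
qed

lemma simple_roots_length_le_2:
  assumes "simple_roots a b \<Psi> \<beta>s"
  shows "length \<beta>s \<le> 2"
proof -
  have "card (set \<beta>s) \<le> DIM(rvec)"
    using assms independent_bound[of "set \<beta>s"] by (simp add: simple_roots_def)
  then show ?thesis using assms by (simp add: simple_roots_def distinct_card)
qed

lemma simple_roots_Phi_empty: "simple_roots a b (Phi a b {}) []"
  by (simp add: simple_roots_def Phi_def orbit_set_def real_vector.independent_empty)

theorem theorem4p8:
  fixes a b :: int and \<Psi> :: "rvec set"
  assumes "a > 0" and "b > 0" and "a \<ge> b" and "a * b \<ge> 4"
    and "Phi_subsystem a b \<Psi>"
  shows
    "(\<Psi> \<noteq> {} \<longrightarrow>
       (\<exists>r. has_data a b \<Psi> [alphaLL a b r] A1_mat ((of_int a / of_int b) \<cdot>\<^sub>m A1_mat)) \<or>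
       (\<exists>r. has_data a b \<Psi> [alphaSU a b r] A1_mat A1_mat) \<or>
       (\<exists>d r. d > 0 \<and> 0 \<le> r \<and> r < d \<and>
          has_data a b \<Psi> [alphaLL a b r, alphaLU a b (d - r - 1)]
            (H_mat (delta a b d) (delta a b d))
            ((of_int a / of_int b) \<cdot>\<^sub>m H_mat (delta a b d) (delta a b d))) \<or>
       (\<exists>d r. d > 0 \<and> 0 \<le> r \<and> r < d \<and>
          has_data a b \<Psi> [alphaSU a b r, alphaSL a b (d - r - 1)]
            (H_mat (delta a b d) (delta a b d))
            (H_mat (delta a b d) (delta a b d))) \<or>
       (\<exists>d r. d \<ge> 0 \<and> - d \<le> r \<and> r \<le> d \<and>
          has_data a b \<Psi> [alphaLL a b r, alphaSU a b (d - r)]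
            (H_mat (a * epsilon a b d) (b * epsilon a b d))
            (B_mat (a * epsilon a b d) (b * epsilon a b d))))
     \<and> (\<exists>k. has_rank a b \<Psi> k) \<and> (\<forall>k. has_rank a b \<Psi> k \<longrightarrow> k \<le> 2)"
    (is "(\<Psi> \<noteq> {} \<longrightarrow> ?I\<^sub>L \<or> ?I\<^sub>S \<or> ?II\<^sub>L \<or> ?II\<^sub>S \<or> ?II\<^sub>L\<^sub>S) \<and> _")
proof -
  interpret infinite_rank2 a b by unfold_locales (use assms in auto)
  obtain \<Gamma> where \<Gamma>: "\<Gamma> \<subseteq> real_roots a b" "\<Psi> = Phi a b \<Gamma>"
    using assms(5) by (auto simp: Phi_subsystem_def)
  define K where "K = {k. chain a b k \<in> \<Psi>}"
  have K: "refl_closed K" and \<Psi>: "\<Psi> = signed_chain a b K"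
    using Phi_eq_signed_chain[of \<Gamma>] \<Gamma> real_roots_subset by (auto simp: K_def)
  have rows: "?I\<^sub>L \<or> ?I\<^sub>S \<or> ?II\<^sub>L \<or> ?II\<^sub>S \<or> ?II\<^sub>L\<^sub>S" if "\<Psi> \<noteq> {}"
  proof -
    have "K \<noteq> {}" using that \<Psi> by (auto simp: signed_chain_def)
    with K show ?thesis
    proof (cases rule: refl_closed_cases)
      case (1 p)
      then have \<Psi>p: "\<Psi> = {chain a b p, - chain a b p}" unfolding \<Psi> signed_chain_def by blast
      show ?thesis
      proof (cases "even p")
        case True
        then obtain r where "p = 2 * r" by auto
        then show ?thesis using has_data_single_long[of r] by (auto simp: \<Psi>p alphas_eq_chain)
      next
        case False
        then obtain s where "p = 2 * s + 1" by (rule oddE)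
        then have "\<Psi> = {alphaSU a b (- s - 1), - alphaSU a b (- s - 1)}"
          by (simp add: \<Psi>p alphas_eq_chain add.commute insert_commute)
        then have ?I\<^sub>S using has_data_single_short[of "- s - 1"] by metis
        then show ?thesis by blast
      qed
    next
      case (2 p D)
      from \<open>D > 0\<close> show ?thesis
      proof (cases rule: progression_cases[where p = p])
        case (even d r)
        then have ?II\<^sub>L using has_data_pair_long[of d r] unfolding \<Psi> 2 by metis
        then show ?thesis by blast
      next
        case (odd d r)
        then have ?II\<^sub>S using has_data_pair_short[of d r] unfolding \<Psi> 2 by metis
        then show ?thesis by blast
      next
        case (mixed d r)
        then have ?II\<^sub>L\<^sub>S using has_data_pair_mixed[of d r] unfolding \<Psi> 2 by metis
        then show ?thesis by blast
      qed
    qed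
  qed
  have "\<exists>\<beta>s. simple_roots a b \<Psi> \<beta>s"
  proof (cases "\<Psi> = {}")
    case True
    then show ?thesis
      using simple_roots_Phi_empty[of a b] by (auto simp: Phi_def orbit_set_def)
  next
    case False
    then show ?thesis using rows unfolding has_data_def by blast
  qed
  then have "\<exists>k. has_rank a b \<Psi> k" by (auto simp: has_rank_def)
  moreover have "\<forall>k. has_rank a b \<Psi> k \<longrightarrow> k \<le> 2"
    using simple_roots_length_le_2 by (auto simp: has_rank_def)
  ultimately show ?thesis using rows by blast
qed

end
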